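(* Let $X\subset\mathbb{R}^p$ be nonempty, let $Y\subset\mathbb{R}^q$ be closed, let $\theta_l,\theta_f:\mathbb{R}^p\times\mathbb{R}^q\to\mathbb{R}$ be functions, and let $K:X\rightrightarrows Y$ be a set-valued map. Fix $\varepsilon>0$ and consider the pessimistic bilevel programming problem $$\min_{x\in X}\left(\sup_{y\in S_\varepsilon(x)}\theta_l(x,y)\right),$$ where $S_\varepsilon(x):=\{y\in K(x) : \theta_f(x,y)\leq\theta_f(x,z)+\varepsilon\ \ \forall z\in K(x)\}$. Assume that (i) $\theta_l$ is lower semicontinuous; (ii) $K:X\rightrightarrows Y$ is both upper and lower semicontinuous, and has nonempty convex values; (iii) $\theta_f$ is continuous and for every $x\in X$, $\theta_f(x,\cdot)$ is strictly convex; (iv) $\operatorname{gph}K$ is compact and $X=\operatorname{dom}K$. Then $S_\varepsilon:X\rightrightarrows Y$ is lower semicontinuous, and the problem admits a solution, i.e. there exists $x^*\in X$ minimizing $x\mapsto\sup_{y\in S_\varepsilon(x)}\theta_l(x,y)\in\mathbb{R}\cup\{+\infty\}$ over $X$.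
   Context: A set-valued map $M:X\rightrightarrows Y$ assigns to each $x\in X$ a subset $M(x)\subset Y$; $\operatorname{dom}M=\{x\in X : M(x)\neq\emptyset\}$ and $\operatorname{gph}M=\{(x,y)\in X\times Y : y\in M(x)\}$. For metric spaces $X,Y$: $M$ is upper semicontinuous at $x_0$ if for every open $V\subset Y$ with $M(x_0)\subset V$ there is a neighborhood $U$ of $x_0$ in $X$ with $M(x)\subset V$ for all $x\in U$; $M$ is lower semicontinuous at $x_0$ if for every open $V\subset Y$ with $M(x_0)\cap V\neq\emptyset$ there is a neighborhood $U$ of $x_0$ in $X$ with $M(x)\cap V\neq\emptyset$ for all $x\in U$. $M$ is upper (lower) semicontinuous if it is so at every point of $X$. The sets $X$ and $Y$ carry the Euclidean metric. *)

theory Defs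
  imports "HOL-Analysis.Analysis"
begin

text \<open>
  A set-valued map from \<open>X\<close> to \<open>Y\<close> is represented by a function \<open>M\<close> with \<open>M x \<subseteq> Y\<close> for all
  \<open>x \<in> X\<close>; its values outside \<open>X\<close> play no role, so \<open>X\<close> (and, where the topology of the codomain
  matters, \<open>Y\<close>) is an explicit parameter below.
\<close>

definition svmap_dom :: "'a set \<Rightarrow> ('a \<Rightarrow> 'b set) \<Rightarrow> 'a set" where
  "svmap_dom X M = {x \<in> X. M x \<noteq> {}}"

definition svmap_gph :: "'a set \<Rightarrow> ('a \<Rightarrow> 'b set) \<Rightarrow> ('a \<times> 'b) set" where
  "svmap_gph X M = {(x, y). x \<in> X \<and> y \<in> M x}"

text \<open>Open sets and neighbourhoods are those of the subspaces \<open>X\<close> and \<open>Y\<close>.\<close>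

definition svmap_usc_at ::
    "'a::metric_space set \<Rightarrow> 'b::metric_space set \<Rightarrow> ('a \<Rightarrow> 'b set) \<Rightarrow> 'a \<Rightarrow> bool" where
  "svmap_usc_at X Y M x0 \<longleftrightarrow>
     (\<forall>V. openin (top_of_set Y) V \<and> M x0 \<subseteq> V \<longrightarrow>
        (\<exists>U. openin (top_of_set X) U \<and> x0 \<in> U \<and> (\<forall>x\<in>U. M x \<subseteq> V)))"

definition svmap_lsc_at ::
    "'a::metric_space set \<Rightarrow> 'b::metric_space set \<Rightarrow> ('a \<Rightarrow> 'b set) \<Rightarrow> 'a \<Rightarrow> bool" where
  "svmap_lsc_at X Y M x0 \<longleftrightarrow>
     (\<forall>V. openin (top_of_set Y) V \<and> M x0 \<inter> V \<noteq> {} \<longrightarrow>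
        (\<exists>U. openin (top_of_set X) U \<and> x0 \<in> U \<and> (\<forall>x\<in>U. M x \<inter> V \<noteq> {})))"

definition svmap_usc ::
    "'a::metric_space set \<Rightarrow> 'b::metric_space set \<Rightarrow> ('a \<Rightarrow> 'b set) \<Rightarrow> bool" where
  "svmap_usc X Y M \<longleftrightarrow> (\<forall>x0\<in>X. svmap_usc_at X Y M x0)"

definition svmap_lsc ::
    "'a::metric_space set \<Rightarrow> 'b::metric_space set \<Rightarrow> ('a \<Rightarrow> 'b set) \<Rightarrow> bool" where
  "svmap_lsc X Y M \<longleftrightarrow> (\<forall>x0\<in>X. svmap_lsc_at X Y M x0)"

definition lsc_fun :: "('a::topological_space \<Rightarrow> real) \<Rightarrow> bool" where
  "lsc_fun f \<longleftrightarrow> (\<forall>z0. \<forall>c < f z0. \<forall>\<^sub>F z in nhds z0. c < f z)"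

definition strictly_convex_on :: "'a::real_vector set \<Rightarrow> ('a \<Rightarrow> real) \<Rightarrow> bool" where
  "strictly_convex_on S f \<longleftrightarrow> convex S \<and>
     (\<forall>x\<in>S. \<forall>y\<in>S. x \<noteq> y \<longrightarrow>
        (\<forall>u>0. \<forall>v>0. u + v = 1 \<longrightarrow> f (u *\<^sub>R x + v *\<^sub>R y) < u * f x + v * f y))"

definition eps_solutions :: "('a \<times> 'b \<Rightarrow> real) \<Rightarrow> ('a \<Rightarrow> 'b set) \<Rightarrow> real \<Rightarrow> 'a \<Rightarrow> 'b set" where
  "eps_solutions \<theta>f K \<epsilon> x = {y \<in> K x. \<forall>z\<in>K x. \<theta>f (x, y) \<le> \<theta>f (x, z) + \<epsilon>}"

text \<open>The supremum is taken in the extended reals, since it need not be finite.\<close>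

definition pessimistic_value ::
    "('a \<times> 'b \<Rightarrow> real) \<Rightarrow> ('a \<times> 'b \<Rightarrow> real) \<Rightarrow> ('a \<Rightarrow> 'b set) \<Rightarrow> real \<Rightarrow> 'a \<Rightarrow> ereal" where
  "pessimistic_value \<theta>l \<theta>f K \<epsilon> x = (SUP y \<in> eps_solutions \<theta>f K \<epsilon> x. ereal (\<theta>l (x, y)))"

end

theory Submission
  imports Defs
begin

text \<open>
  If \<open>K x\<^sub>0\<close> is convex and \<open>m\<close> minimizes the follower's objective on it, moving an
  \<open>\<epsilon>\<close>-solution slightly towards \<open>m\<close> makes the \<open>\<epsilon>\<close>-inequality strict. A strict
  \<open>\<epsilon>\<close>-solution persists under perturbation of \<open>x\<^sub>0\<close>, because \<open>K\<close> is lower semicontinuous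
  with compact graph; hence \<open>S\<^sub>\<epsilon>\<close> is lower semicontinuous. A supremum of a lower semicontinuous
  function over a lower semicontinuous set-valued map is lower semicontinuous, so it attains its
  minimum on the compact set \<open>X\<close>.
\<close>

text \<open>Since \<open>M x0\<close> lies in \<open>Y\<close>, intersecting \<open>W\<close> with
  \<open>Y\<close> loses no point of it. Lower semicontinuity can then be applied to open sets of
  the whole space, such as factors of open boxes.\<close>

lemma svmap_lsc_atE:
  assumes "svmap_lsc_at X Y M x0" "M x0 \<subseteq> Y" "y0 \<in> M x0" "y0 \<in> W" "open W"
  obtains U where "openin (top_of_set X) U" "x0 \<in> U" "\<And>x. x \<in> U \<Longrightarrow> M x \<inter> W \<noteq> {}"
proof -
  have "openin (top_of_set Y) (Y \<inter> W)"
    using assms(5) by auto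
  moreover have "M x0 \<inter> (Y \<inter> W) \<noteq> {}"
    using assms by auto
  ultimately obtain U where "openin (top_of_set X) U" "x0 \<in> U" "\<forall>x\<in>U. M x \<inter> (Y \<inter> W) \<noteq> {}"
    using assms(1) unfolding svmap_lsc_at_def by meson
  then show thesis
    by (intro that[of U]) auto
qed

lemma open_prod_boxE:
  assumes "open S" "(x, y) \<in> S"
  obtains A B where "open A" "open B" "x \<in> A" "y \<in> B" "A \<times> B \<subseteq> S"
  using assms by (auto elim: open_prod_elim)

lemma open_lsc_fun_superlevel:
  assumes "lsc_fun f"
  shows "open {z. c < ereal (f z)}"
proof (cases c)
  case (real r)
  have "open {z. r < f z}"
  proof (rule Topological_Spaces.openI)
    fix z
    assume "z \<in> {z. r < f z}"
    then have "\<forall>\<^sub>F z in nhds z. r < f z"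
      using assms unfolding lsc_fun_def by simp
    then show "\<exists>T. open T \<and> z \<in> T \<and> T \<subseteq> {z. r < f z}"
      unfolding eventually_nhds by blast
  qed
  then show ?thesis
    unfolding real by simp
qed auto

text \<open>A supremum above \<open>c\<close> is witnessed by a single \<open>y0\<close>, and
  \<open>f\<close> stays above \<open>c\<close> on a box \<open>A \<times> B\<close> around
  \<open>(x0, y0)\<close>. Lower semicontinuity of \<open>M\<close> keeps a point of
  \<open>M x\<close> in \<open>B\<close> for \<open>x\<close> near \<open>x0\<close>, and that point
  is a witness at \<open>x\<close>.\<close>

lemma openin_SUP_superlevel:
  fixes f :: "'a::metric_space \<times> 'b::metric_space \<Rightarrow> real"
  assumes f: "lsc_fun f" and M: "svmap_lsc X Y M" and sub: "\<And>x. x \<in> X \<Longrightarrow> M x \<subseteq> Y"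
  shows "openin (top_of_set X) {x \<in> X. c < (SUP y\<in>M x. ereal (f (x, y)))}"
proof (subst openin_subopen, safe)
  fix x0
  assume x0: "x0 \<in> X" and "c < (SUP y\<in>M x0. ereal (f (x0, y)))"
  then obtain y0 where y0: "y0 \<in> M x0" "c < ereal (f (x0, y0))"
    by (auto simp: less_SUP_iff)
  obtain A B where AB: "open A" "open B" "x0 \<in> A" "y0 \<in> B"
    and box: "A \<times> B \<subseteq> {z. c < ereal (f z)}"
    using open_prod_boxE[OF open_lsc_fun_superlevel[OF f, of c], of x0 y0] y0(2) by blast
  obtain U where U: "openin (top_of_set X) U" "x0 \<in> U" "\<And>x. x \<in> U \<Longrightarrow> M x \<inter> B \<noteq> {}"
    using svmap_lsc_atE[of X Y M x0 y0 B] M x0 y0(1) AB sub unfolding svmap_lsc_def by blast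
  have "c < (SUP y\<in>M x. ereal (f (x, y)))" if "x \<in> U \<inter> A" for x
    using U(3)[of x] that box by (force simp: less_SUP_iff)
  moreover have "U \<subseteq> X"
    using U(1) by (rule openin_imp_subset)
  ultimately show "\<exists>T. openin (top_of_set X) T \<and> x0 \<in> T \<and>
      T \<subseteq> {x \<in> X. c < (SUP y\<in>M x. ereal (f (x, y)))}"
    using U AB by (intro exI[of _ "U \<inter> A"]) (auto intro: openin_Int_open)
qed

text \<open>Without a minimizer, the strict superlevel sets of \<open>v\<close> at its own values
  cover \<open>X\<close>. A finite subcover has an index with least value, and no set of the
  subcover contains that index.\<close>

lemma compact_lsc_attains_min:
  fixes v :: "'a::topological_space \<Rightarrow> 'b::linorder"
  assumes "compact X" "X \<noteq> {}" and lsc: "\<And>c. openin (top_of_set X) {x \<in> X. c < v x}"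
  shows "\<exists>x. is_arg_min v (\<lambda>x. x \<in> X) x"
proof (rule ccontr)
  assume "\<nexists>x. is_arg_min v (\<lambda>x. x \<in> X) x"
  then have "X \<subseteq> (\<Union>x'\<in>X. {x \<in> X. v x' < v x})"
    unfolding is_arg_min_def by auto
  moreover have "\<forall>S\<in>(\<lambda>x'. {x \<in> X. v x' < v x}) ` X. openin (top_of_set X) S"
    using lsc by blast
  ultimately obtain D where D: "D \<subseteq> (\<lambda>x'. {x \<in> X. v x' < v x}) ` X" "finite D" "X \<subseteq> \<Union>D"
    using assms(1) unfolding compact_eq_openin_cover by meson
  from finite_subset_image[OF D(2,1)] obtain F where F: "finite F" "F \<subseteq> X" "D = (\<lambda>x'. {x \<in> X. v x' < v x}) ` F"
    by blast
  have "F \<noteq> {}"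
    using D(3) F(3) \<open>X \<noteq> {}\<close> by blast
  with F(1) obtain m where "m \<in> F" "\<And>x. x \<in> F \<Longrightarrow> v m \<le> v x"
    using ex_is_arg_min_if_finite[of F v] by (auto simp: is_arg_min_linorder)
  moreover obtain x where "x \<in> F" "v x < v m"
    using D(3) F(2,3) \<open>m \<in> F\<close> by blast
  ultimately show False
    by (simp add: leD)
qed

text \<open>The value is the projection of a slice of the graph; the slice is compact because
  singletons are closed in a T1 space.\<close>

lemma compact_svmap_value:
  fixes K :: "'a::t1_space \<Rightarrow> 'b::topological_space set"
  assumes "compact (svmap_gph X K)" "x \<in> X"
  shows "compact (K x)"
proof -
  have Kx: "K x = snd ` (svmap_gph X K \<inter> ({x} \<times> UNIV))"
    using assms(2) by (force simp: svmap_gph_def)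
  have "compact (svmap_gph X K \<inter> ({x} \<times> UNIV))"
    using assms(1) by (intro compact_Int_closed closed_Times) auto
  then have "compact (snd ` (svmap_gph X K \<inter> ({x} \<times> UNIV)))"
    by (intro compact_continuous_image continuous_intros)
  then show ?thesis
    unfolding Kx .
qed

lemma svmap_value_attains_min:
  fixes K :: "'a::t1_space \<Rightarrow> 'b::topological_space set" and g :: "'a \<times> 'b \<Rightarrow> real"
  assumes "compact (svmap_gph X K)" "x \<in> X" "K x \<noteq> {}" "continuous_on UNIV g"
  obtains m where "m \<in> K x" "\<And>z. z \<in> K x \<Longrightarrow> g (x, m) \<le> g (x, z)"
proof -
  have "continuous_on (K x) (\<lambda>y. g (x, y))"
    by (rule continuous_on_compose2[OF assms(4)]) (auto intro!: continuous_intros)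
  then show thesis
    using continuous_attains_inf[OF compact_svmap_value[OF assms(1,2)] assms(3)] that by blast
qed

text \<open>Moving from \<open>y0\<close> towards \<open>m\<close> by a fraction \<open>t\<close>
  bounds \<open>g\<close> by \<open>(1 - t) * (g m + \<epsilon>) + t * g m\<close>, which is
  \<open>g m + \<epsilon> - t * \<epsilon>\<close>. For small \<open>t > 0\<close> the point is
  still in \<open>W\<close>.\<close>

lemma strict_eps_solution_near:
  fixes g :: "'b::real_normed_vector \<Rightarrow> real"
  assumes "convex C" and g: "strictly_convex_on UNIV g" and "open W"
    and y0: "y0 \<in> C" "y0 \<in> W" "g y0 \<le> g m + \<epsilon>" and m: "m \<in> C" and "\<epsilon> > 0"
  obtains y1 where "y1 \<in> C" "y1 \<in> W" "g y1 < g m + \<epsilon>"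
proof (cases "y0 = m")
  case True
  then show thesis
    using that[of y0] y0 \<open>\<epsilon> > 0\<close> by auto
next
  case False
  have "((\<lambda>t. (1 - t) *\<^sub>R y0 + t *\<^sub>R m) \<longlongrightarrow> (1 - 0) *\<^sub>R y0 + 0 *\<^sub>R m) (at_right (0::real))"
    by (intro tendsto_intros)
  then have "\<forall>\<^sub>F t in at_right (0::real). (1 - t) *\<^sub>R y0 + t *\<^sub>R m \<in> W"
    using \<open>open W\<close> y0(2) by (simp add: topological_tendstoD)
  moreover have "\<forall>\<^sub>F t in at_right (0::real). t \<in> {0<..<1}"
    by (rule eventually_at_right_real) simp
  ultimately have "\<forall>\<^sub>F t in at_right (0::real). (1 - t) *\<^sub>R y0 + t *\<^sub>R m \<in> W \<and> t \<in> {0<..<1}"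
    by eventually_elim auto
  then obtain t :: real where t: "(1 - t) *\<^sub>R y0 + t *\<^sub>R m \<in> W" "0 < t" "t < 1"
    using eventually_happens'[OF trivial_limit_at_right_real] by fastforce
  let ?y = "(1 - t) *\<^sub>R y0 + t *\<^sub>R m"
  have "?y \<in> C"
    using \<open>convex C\<close> y0(1) m t by (intro convexD) auto
  moreover have "g ?y < (1 - t) * g y0 + t * g m"
    using g False t unfolding strictly_convex_on_def by simp
  moreover have "(1 - t) * g y0 \<le> (1 - t) * (g m + \<epsilon>)"
    using t y0(3) by (intro mult_left_mono) auto
  moreover have "0 < t * \<epsilon>"
    using t \<open>\<epsilon> > 0\<close> by simp
  ultimately show thesis
    using that[of ?y] t(1) by (simp add: algebra_simps)
qed

lemma svmap_lsc_eps_solutions: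
  fixes K :: "'a::metric_space \<Rightarrow> 'b::real_normed_vector set" and \<theta>f :: "'a \<times> 'b \<Rightarrow> real"
  assumes sub: "\<And>x. x \<in> X \<Longrightarrow> K x \<subseteq> Y" and "\<epsilon> > 0" and lsc: "svmap_lsc X Y K"
    and ne: "\<And>x. x \<in> X \<Longrightarrow> K x \<noteq> {}" and conv: "\<And>x. x \<in> X \<Longrightarrow> convex (K x)"
    and cont: "continuous_on UNIV \<theta>f"
    and sc: "\<And>x. x \<in> X \<Longrightarrow> strictly_convex_on UNIV (\<lambda>y. \<theta>f (x, y))"
    and comp: "compact (svmap_gph X K)"
  shows "svmap_lsc X Y (eps_solutions \<theta>f K \<epsilon>)"
  unfolding svmap_lsc_def svmap_lsc_at_def
proof (intro ballI allI impI, elim conjE)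
  fix x0 V
  assume x0: "x0 \<in> X" and "openin (top_of_set Y) V" and meet: "eps_solutions \<theta>f K \<epsilon> x0 \<inter> V \<noteq> {}"
  then obtain W where W: "open W" "V = Y \<inter> W"
    by (auto simp: openin_open)
  from meet obtain y0 where y0: "y0 \<in> K x0" "y0 \<in> W" "\<And>z. z \<in> K x0 \<Longrightarrow> \<theta>f (x0, y0) \<le> \<theta>f (x0, z) + \<epsilon>"
    unfolding W(2) eps_solutions_def by blast
  obtain m where m: "m \<in> K x0" "\<And>z. z \<in> K x0 \<Longrightarrow> \<theta>f (x0, m) \<le> \<theta>f (x0, z)"
    using svmap_value_attains_min[OF comp x0 ne[OF x0] cont] by blast
  obtain y1 where y1: "y1 \<in> K x0" "y1 \<in> W" "\<theta>f (x0, y1) < \<theta>f (x0, m) + \<epsilon>"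
    using strict_eps_solution_near[OF conv[OF x0] sc[OF x0] W(1) y0(1,2) y0(3)[OF m(1)] m(1) \<open>\<epsilon> > 0\<close>] .
  \<comment> \<open>The threshold \<open>c\<close> splits the strict inequality into two conditions
    that can be kept separately near \<open>x0\<close>: the objective at a nearby feasible point
    stays below \<open>c\<close>, and \<open>\<epsilon>\<close> plus the objective stays above
    \<open>c\<close> at all feasible points.\<close>
  then obtain c where c: "\<theta>f (x0, y1) < c" "c < \<theta>f (x0, m) + \<epsilon>"
    using dense by blast
  have "open {z. \<theta>f z < c}"
    using cont by (intro open_Collect_less) auto
  then obtain A B where AB: "open A" "open B" "x0 \<in> A" "y1 \<in> B" and box: "A \<times> B \<subseteq> {z. \<theta>f z < c}"
    using open_prod_boxE[of "{z. \<theta>f z < c}" x0 y1] c(1) by blast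
  \<comment> \<open>Using \<open>W \<inter> B\<close> gives one feasible point that both lies in
    \<open>W\<close> and has objective below \<open>c\<close>.\<close>
  obtain U where U: "openin (top_of_set X) U" "x0 \<in> U" "\<And>x. x \<in> U \<Longrightarrow> K x \<inter> (W \<inter> B) \<noteq> {}"
    using svmap_lsc_atE[of X Y K x0 y1 "W \<inter> B"] lsc x0 sub y1 W(1) AB
    unfolding svmap_lsc_def by (metis IntI open_Int)
  \<comment> \<open>\<open>D\<close> is the set of bad parameters, those where some feasible
    \<open>z\<close> violates the second condition. As the projection of a compact set it is closed,
    so avoiding it is an open condition; minimality of \<open>m\<close> keeps \<open>x0\<close>
    outside.\<close>
  define D where "D = fst ` (svmap_gph X K \<inter> {z. \<theta>f z + \<epsilon> \<le> c})"
  have "closed {z. \<theta>f z + \<epsilon> \<le> c}"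
    using cont by (intro closed_Collect_le continuous_intros) auto
  then have "compact D"
    unfolding D_def using comp by (intro compact_continuous_image compact_Int_closed continuous_intros)
  then have "open (- D)"
    using compact_imp_closed by blast
  have "x0 \<notin> D"
    using m(2) c(2) unfolding D_def svmap_gph_def by force
  have "U \<subseteq> X"
    using U(1) by (rule openin_imp_subset)
  have "eps_solutions \<theta>f K \<epsilon> x \<inter> V \<noteq> {}" if x: "x \<in> U \<inter> A \<inter> - D" for x
  proof -
    have "x \<in> X"
      using x \<open>U \<subseteq> X\<close> by auto
    obtain y where y: "y \<in> K x" "y \<in> W" "y \<in> B"
      using U(3) x by blast
    have "\<theta>f (x, y) < c"
      using box x y(3) by auto
    moreover have "c < \<theta>f (x, z) + \<epsilon>" if "z \<in> K x" for z
      using x that \<open>x \<in> X\<close> unfolding D_def svmap_gph_def by force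
    ultimately have "y \<in> eps_solutions \<theta>f K \<epsilon> x"
      using y(1) unfolding eps_solutions_def by fastforce
    then show ?thesis
      using y sub[OF \<open>x \<in> X\<close>] W(2) by auto
  qed
  moreover have "openin (top_of_set X) (U \<inter> A \<inter> - D)"
    using U(1) AB(1) \<open>open (- D)\<close> by (intro openin_Int_open)
  ultimately show "\<exists>U. openin (top_of_set X) U \<and> x0 \<in> U \<and> (\<forall>x\<in>U. eps_solutions \<theta>f K \<epsilon> x \<inter> V \<noteq> {})"
    using U(2) AB(3) \<open>x0 \<notin> D\<close> by (intro exI[of _ "U \<inter> A \<inter> - D"]) auto
qed

theorem theorem2p3p4:
  fixes X :: "(real ^ 'p) set" and Y :: "(real ^ 'q) set"
    and \<theta>l \<theta>f :: "(real ^ 'p) \<times> (real ^ 'q) \<Rightarrow> real"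
    and K :: "real ^ 'p \<Rightarrow> (real ^ 'q) set"
    and \<epsilon> :: real
  assumes "X \<noteq> {}" and "closed Y"
    and "\<And>x. x \<in> X \<Longrightarrow> K x \<subseteq> Y"
    and "\<epsilon> > 0"
    and "lsc_fun \<theta>l"
    and "svmap_usc X Y K" and "svmap_lsc X Y K"
    and "\<And>x. x \<in> X \<Longrightarrow> K x \<noteq> {}" and "\<And>x. x \<in> X \<Longrightarrow> convex (K x)"
    and "continuous_on UNIV \<theta>f"
    and "\<And>x. x \<in> X \<Longrightarrow> strictly_convex_on UNIV (\<lambda>y. \<theta>f (x, y))"
    and "compact (svmap_gph X K)" and "X = svmap_dom X K"
  shows "svmap_lsc X Y (eps_solutions \<theta>f K \<epsilon>) \<and>
    (\<forall>x\<in>X. pessimistic_value \<theta>l \<theta>f K \<epsilon> x \<noteq> -\<infinity>) \<and>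
    (\<exists>xs. is_arg_min (pessimistic_value \<theta>l \<theta>f K \<epsilon>) (\<lambda>x. x \<in> X) xs)"
proof (intro conjI ballI)
  show lsc: "svmap_lsc X Y (eps_solutions \<theta>f K \<epsilon>)"
    using assms by (intro svmap_lsc_eps_solutions)
  \<comment> \<open>The supremum of the empty set in \<open>ereal\<close> is minus infinity, so an
    \<epsilon>-solution has to be exhibited; an exact minimizer is one.\<close>
  show "pessimistic_value \<theta>l \<theta>f K \<epsilon> x \<noteq> -\<infinity>" if x: "x \<in> X" for x
  proof -
    obtain m where "m \<in> K x" "\<And>z. z \<in> K x \<Longrightarrow> \<theta>f (x, m) \<le> \<theta>f (x, z)"
      using svmap_value_attains_min[OF assms(12) x assms(8)[OF x] assms(10)] by blast
    then have "m \<in> eps_solutions \<theta>f K \<epsilon> x"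
      using \<open>\<epsilon> > 0\<close> unfolding eps_solutions_def by fastforce
    then have "ereal (\<theta>l (x, m)) \<le> pessimistic_value \<theta>l \<theta>f K \<epsilon> x"
      unfolding pessimistic_value_def by (rule SUP_upper)
    then show ?thesis
      by auto
  qed
  \<comment> \<open>Nonempty values make the graph project onto all of \<open>X\<close>, which
    transfers compactness to \<open>X\<close>.\<close>
  have "X = fst ` svmap_gph X K"
    using assms(8) unfolding svmap_gph_def by force
  moreover have "compact (fst ` svmap_gph X K)"
    using assms(12) by (intro compact_continuous_image continuous_intros)
  ultimately have "compact X"
    by simp
  moreover have "eps_solutions \<theta>f K \<epsilon> x \<subseteq> Y" if "x \<in> X" for x
    using assms(3)[OF that] unfolding eps_solutions_def by auto
  ultimately show "\<exists>xs. is_arg_min (pessimistic_value \<theta>l \<theta>f K \<epsilon>) (\<lambda>x. x \<in> X) xs"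
    using \<open>X \<noteq> {}\<close> openin_SUP_superlevel[OF \<open>lsc_fun \<theta>l\<close> lsc]
    by (intro compact_lsc_attains_min) (auto simp: pessimistic_value_def)
qed

end
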